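(* Let $n\ge 4$ and let $p_n(x)=\det(xI-C)$ be the characteristic polynomial of the $n\times n$ affine Cartan matrix $C$ of type $B_{n-1}^{(1)}$. Then $$p_n(x)=x(x-2)(x-4)\sum_{j=0}^{n-3}(-1)^{n+j+1}\binom{n+j-2}{2j+1}x^j .$$
   Context: The $n\times n$ matrix $C=(C_{i,j})_{1\le i,j\le n}$ of type $B_{n-1}^{(1)}$ has $C_{i,i}=2$ for all $i$, $C_{1,3}=C_{3,1}=-1$, $C_{i,i+1}=C_{i+1,i}=-1$ for $2\le i\le n-2$, $C_{n-1,n}=-2$, $C_{n,n-1}=-1$, and all other entries $0$. *)

theory Defs
  imports "Jordan_Normal_Form.Char_Poly"
begin

text \<open>
  The entry function uses the indices \<open>1, \<dots>, n\<close>; the rows and columns of a matrix of type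
  \<^typ>\<open>int mat\<close> are numbered from \<open>0\<close>, hence the shift by \<open>Suc\<close> in \<open>cartan_B_affine\<close>.
  The parameter \<open>n\<close> is the size of the matrix, so its type is \<open>B\<close> of rank \<open>n - 1\<close>, affine.
\<close>

definition cartan_B_affine_entry :: "nat \<Rightarrow> nat \<Rightarrow> nat \<Rightarrow> int" where
  "cartan_B_affine_entry n i j =
    (if i = j then 2
     else if (i = 1 \<and> j = 3) \<or> (i = 3 \<and> j = 1) then -1
     else if 2 \<le> i \<and> i \<le> n - 2 \<and> j = i + 1 then -1
     else if 2 \<le> j \<and> j \<le> n - 2 \<and> i = j + 1 then -1
     else if i = n - 1 \<and> j = n then -2
     else if i = n \<and> j = n - 1 then -1
     else 0)"

definition cartan_B_affine :: "nat \<Rightarrow> int mat" where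
  "cartan_B_affine n = mat n n (\<lambda>(i, j). cartan_B_affine_entry n (Suc i) (Suc j))"

end

theory Submission
  imports Defs
begin

text \<open>
  Put \<open>y = x - 2\<close>. Then \<open>xI - C\<close> is \<open>y I\<close> plus the weighted adjacency matrix of the Dynkin
  diagram, a tree: a path \<open>2, 3, \<dots>, n\<close> whose last edge has weight product \<open>2\<close>, together with a
  leaf \<open>1\<close> attached to vertex \<open>3\<close>. The determinant of such a matrix can be computed by removing
  leaves (\<open>det_pendant_vertex\<close>). Write \<open>D\<^sub>k\<close> for the determinant of the path on the last \<open>k\<close>
  vertices. Removing leaf \<open>1\<close> leaves the path on \<open>n - 1\<close> vertices; removing its neighbour \<open>3\<close>
  as well isolates vertex \<open>2\<close> and leaves the path on \<open>n - 3\<close> vertices. Hence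
  \<open>p\<^sub>n = y (D\<^bsub>n-1\<^esub> - D\<^bsub>n-3\<^esub>)\<close>.

  Removing the first vertex of the path gives \<open>D\<^bsub>k+2\<^esub> = y D\<^bsub>k+1\<^esub> - D\<^sub>k\<close> for \<open>k \<ge> 1\<close>,
  the recurrence of the Chebyshev polynomials in \<open>y / 2\<close>. The differences
  \<open>D\<^bsub>m+2\<^esub> - D\<^sub>m\<close> satisfy it too, and their values at \<open>m = 1\<close> and \<open>m = 2\<close> show that, for
  \<open>m \<ge> 1\<close>, they are \<open>(y\<^sup>2 - 4) U\<^sub>m\<close>, where \<open>U\<^sub>0 = 1\<close> and \<open>U\<^sub>1 = y\<close>
  (\<open>det_path_mat_diff\<close>). Since \<open>y\<^sup>2 - 4 = x (x - 4)\<close>, this gives the three linear factors, and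
  the remaining factor is \<open>U\<^bsub>n-3\<^esub>\<close>. Its coefficients in powers of \<open>x\<close> are the stated binomial
  coefficients because these obey the same recurrence, by Pascal's rule
  (\<open>cheb_poly_rec\<close>).
\<close>

text \<open>
  Index \<open>0\<close> plays the role of a leaf whose only neighbour is \<open>k\<close>. In the Leibniz expansion a
  permutation with nonzero contribution either fixes \<open>0\<close> or swaps \<open>0\<close> and \<open>k\<close>. The second
  deletion is at \<open>k - 1\<close> because the first one has shifted the indices.
\<close>
lemma det_pendant_vertex:
  fixes A :: "'a :: comm_ring_1 mat"
  assumes A: "A \<in> carrier_mat n n" and k: "0 < k" "k < n"
    and row: "\<And>j. j < n \<Longrightarrow> j \<noteq> 0 \<Longrightarrow> j \<noteq> k \<Longrightarrow> A $$ (0, j) = 0"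
    and col: "\<And>i. i < n \<Longrightarrow> i \<noteq> 0 \<Longrightarrow> i \<noteq> k \<Longrightarrow> A $$ (i, 0) = 0"
  shows "det A = A $$ (0, 0) * det (mat_delete A 0 0)
    - A $$ (0, k) * A $$ (k, 0) * det (mat_delete (mat_delete A 0 0) (k - 1) (k - 1))"
proof -
  define B where "B = mat_delete A 0 k"
  have B: "B \<in> carrier_mat (n - 1) (n - 1)"
    using A unfolding B_def by (rule mat_delete_carrier)
  have B_col: "B $$ (i, 0) = A $$ (Suc i, 0)" if "i < n - 1" for i
    using that A k by (auto simp: B_def mat_delete_def)
  have "det A = (\<Sum>j<n. A $$ (0, j) * cofactor A 0 j)"
    using A k by (intro laplace_expansion_row) auto
  also have "\<dots> = (\<Sum>j\<in>{0, k}. A $$ (0, j) * cofactor A 0 j)"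
    using k row by (intro sum.mono_neutral_right) auto
  finally have det_A: "det A = A $$ (0, 0) * det (mat_delete A 0 0) + A $$ (0, k) * ((-1) ^ k * det B)"
    using k by (simp add: cofactor_def B_def)
  have "det B = (\<Sum>i<n - 1. B $$ (i, 0) * cofactor B i 0)"
    using B k by (intro laplace_expansion_column) auto
  also have "\<dots> = (\<Sum>i\<in>{k - 1}. B $$ (i, 0) * cofactor B i 0)"
  proof (rule sum.mono_neutral_right)
    show "\<forall>i\<in>{..<n - 1} - {k - 1}. B $$ (i, 0) * cofactor B i 0 = 0"
    proof
      fix i
      assume "i \<in> {..<n - 1} - {k - 1}"
      then have "Suc i < n" "Suc i \<noteq> k" "i < n - 1"
        using k by auto
      then show "B $$ (i, 0) * cofactor B i 0 = 0"
        by (simp add: B_col col)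
    qed
  qed (use k in auto)
  also have "\<dots> = A $$ (k, 0) * ((-1) ^ (k - 1) * det (mat_delete B (k - 1) 0))"
    using k B_col by (simp add: cofactor_def)
  also have "mat_delete B (k - 1) 0 = mat_delete (mat_delete A 0 0) (k - 1) (k - 1)"
    using A k by (intro eq_matI) (auto simp: B_def mat_delete_def)
  finally have det_B: "det B = A $$ (k, 0) *
    ((-1) ^ (k - 1) * det (mat_delete (mat_delete A 0 0) (k - 1) (k - 1)))" .
  have sign: "(-1) ^ k * ((-1) ^ (k - 1) * c) = - c" for c :: 'a
    using k by (cases k) simp_all
  have "(-1) ^ k * det B = - (A $$ (k, 0) * det (mat_delete (mat_delete A 0 0) (k - 1) (k - 1)))"
    unfolding det_B by (subst mult.left_commute[of "A $$ (k, 0)"]) (rule sign)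
  then show ?thesis
    unfolding det_A by (simp add: mult.assoc)
qed

text \<open>
  Vertices are numbered from the end of the path that carries the double edge. With this
  numbering, the entries do not depend on the length of the path, so that deleting the first
  row and column of the matrix of a path gives the matrix of a shorter one.
\<close>
definition path_entry :: "'a :: comm_ring_1 \<Rightarrow> nat \<Rightarrow> nat \<Rightarrow> 'a" where
  "path_entry y a b =
    (if a = b then y
     else if a = Suc b then (if b = 0 then 2 else 1)
     else if b = Suc a then 1
     else 0)"

definition path_mat :: "'a :: comm_ring_1 \<Rightarrow> nat \<Rightarrow> 'a mat" where
  "path_mat y k = mat k k (\<lambda>(i, j). path_entry y (k - 1 - i) (k - 1 - j))"

lemma path_mat_carrier: "path_mat y k \<in> carrier_mat k k"
  by (simp add: path_mat_def)

lemma mat_delete_path_mat: "mat_delete (path_mat y (Suc k)) 0 0 = path_mat y k"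
  by (intro eq_matI) (auto simp: path_mat_def mat_delete_def)

lemma det_path_mat_1: "det (path_mat y (Suc 0)) = y"
  by (subst det_single) (auto simp: path_mat_def path_entry_def)

text \<open>The weight of the edge from the first vertex to the second is \<open>2\<close> only on a path with
  two vertices.\<close>
lemma det_path_mat_rec:
  "det (path_mat y (Suc (Suc k))) =
    y * det (path_mat y (Suc k)) - (if k = 0 then 2 else 1) * det (path_mat y k)"
proof -
  have "det (path_mat y (Suc (Suc k))) =
      path_mat y (Suc (Suc k)) $$ (0, 0) * det (path_mat y (Suc k))
      - path_mat y (Suc (Suc k)) $$ (0, 1) * path_mat y (Suc (Suc k)) $$ (1, 0)
        * det (path_mat y k)"
    by (subst det_pendant_vertex[OF path_mat_carrier, of 1])
       (auto simp: mat_delete_path_mat, auto simp: path_mat_def path_entry_def)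
  then show ?thesis
    by (simp add: path_mat_def path_entry_def)
qed

text \<open>
  This is the Chebyshev polynomial \<open>U\<^sub>m\<close> of the second kind, evaluated at \<open>(x - 2) / 2\<close> and
  expanded in powers of \<open>x\<close>.
\<close>
definition cheb_poly :: "nat \<Rightarrow> int poly" where
  "cheb_poly m = (\<Sum>j = 0..m. monom ((-1) ^ (m + j) * int ((m + j + 1) choose (2 * j + 1))) j)"

lemma coeff_cheb_poly:
  "coeff (cheb_poly m) j = (-1) ^ (m + j) * int ((m + j + 1) choose (2 * j + 1))"
  by (auto simp: cheb_poly_def coeff_sum if_distrib binomial_eq_0 simp del: binomial_Suc_Suc cong: if_cong)

lemma cheb_poly_0: "cheb_poly 0 = 1"
  by (simp add: cheb_poly_def)

lemma cheb_poly_1: "cheb_poly (Suc 0) = [:-2, 1:]"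
  by (simp add: cheb_poly_def monom_altdef numeral_eq_Suc)

text \<open>
  Comparing coefficients of \<open>x^j\<close> and dropping the sign, the claim with \<open>N = m + j + 1\<close> is
  \<open>(N+2 choose 2j+1) = (N choose 2j-1) + 2 (N+1 choose 2j+1) - (N choose 2j+1)\<close>; expanding
  everything in terms of \<open>N\<close> by Pascal's rule proves it. The case \<open>j = 0\<close> has no term from the
  multiplication by \<open>x\<close>.
\<close>
lemma cheb_poly_rec:
  "cheb_poly (Suc (Suc m)) = [:-2, 1:] * cheb_poly (Suc m) - cheb_poly m"
proof (rule poly_eqI)
  fix j
  show "coeff (cheb_poly (Suc (Suc m))) j =
    coeff ([:-2, 1:] * cheb_poly (Suc m) - cheb_poly m) j"
    by (cases j) (simp_all add: coeff_cheb_poly coeff_pCons algebra_simps)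
qed

text \<open>
  Both sides satisfy the Chebyshev recurrence in \<open>m\<close>, and they agree for two initial values.
  The shift by one is due to the empty path: its determinant is \<open>1\<close>, whereas extending the
  recurrence downwards would require \<open>D\<^sub>0 = 2\<close>.
\<close>
lemma det_path_mat_diff:
  fixes y :: "int poly"
  assumes y: "y = [:-2, 1:]"
  shows "det (path_mat y (m + 3)) - det (path_mat y (m + 1)) = (y * y - 4) * cheb_poly (m + 1)"
proof (induction m rule: induct_nat_012)
  case 0
  have "det (path_mat y 0) = 1"
    by (simp add: path_mat_def det_dim_zero)
  then show ?case
    by (simp add: numeral_eq_Suc det_path_mat_rec det_path_mat_1 cheb_poly_1 y[symmetric])
       (simp add: algebra_simps)
next
  case 1
  have "det (path_mat y 0) = 1"
    by (simp add: path_mat_def det_dim_zero)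
  then show ?case
    by (simp add: numeral_eq_Suc det_path_mat_rec det_path_mat_1 cheb_poly_rec cheb_poly_0
          cheb_poly_1 y[symmetric])
       (simp add: algebra_simps)
next
  case (ge2 m)
  have "det (path_mat y (Suc (Suc m) + 3)) - det (path_mat y (Suc (Suc m) + 1)) =
      y * (det (path_mat y (Suc m + 3)) - det (path_mat y (Suc m + 1)))
      - (det (path_mat y (m + 3)) - det (path_mat y (m + 1)))"
    by (simp add: numeral_3_eq_3 det_path_mat_rec[of y "Suc _"] algebra_simps)
  also have "\<dots> = (y * y - 4) * (y * cheb_poly (Suc m + 1) - cheb_poly (m + 1))"
    unfolding ge2 by (simp add: algebra_simps)
  also have "y * cheb_poly (Suc m + 1) - cheb_poly (m + 1) = cheb_poly (Suc (Suc m) + 1)"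
    by (simp add: cheb_poly_rec y)
  finally show ?case .
qed

text \<open>
  Vertices \<open>1\<close> and \<open>3\<close> are the indices \<open>0\<close> and \<open>2\<close>. After the deletion of both, vertex \<open>2\<close> is
  index \<open>0\<close> and has no neighbours.
\<close>
lemma char_poly_cartan_B_affine_eq_paths:
  fixes y :: "int poly"
  assumes y: "y = [:-2, 1:]"
  shows "char_poly (cartan_B_affine (m + 4)) =
    y * (det (path_mat y (m + 3)) - det (path_mat y (m + 1)))"
proof -
  define A where "A = char_poly_matrix (cartan_B_affine (m + 4))"
  have A: "A \<in> carrier_mat (m + 4) (m + 4)"
    by (simp add: A_def cartan_B_affine_def char_poly_matrix_def)
  have A_entry: "A $$ (i, j) = (if i = j then y
      else [:- cartan_B_affine_entry (m + 4) (Suc i) (Suc j):])"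
    if "i < m + 4" "j < m + 4" for i j
    using that
    by (auto simp: A_def cartan_B_affine_def char_poly_matrix_def cartan_B_affine_entry_def y)
  have A_path: "mat_delete A 0 0 = path_mat y (m + 3)"
  proof (rule eq_matI)
    fix i j
    assume "i < dim_row (path_mat y (m + 3))" "j < dim_col (path_mat y (m + 3))"
    then have ij: "i < m + 3" "j < m + 3"
      by (simp_all add: path_mat_def)
    have "mat_delete A 0 0 $$ (i, j) = A $$ (Suc i, Suc j)"
      using ij A by (auto simp: mat_delete_def)
    also have "\<dots> = path_entry y (m + 2 - i) (m + 2 - j)"
    proof -
      consider "i = j" | "j = Suc i" | "i = Suc j" | "i \<noteq> j" "j \<noteq> Suc i" "i \<noteq> Suc j"
        by blast
      then show ?thesis
      proof cases
        case 2
        \<comment> \<open>The index \<open>m + 1\<close> singles out the double edge at the end of the path.\<close>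
        with ij show ?thesis
          by (cases "i = m + 1")
             (auto simp: A_entry cartan_B_affine_entry_def path_entry_def numeral_poly)
      next
        case 3
        with ij show ?thesis
          by (cases "j = m + 1")
             (auto simp: A_entry cartan_B_affine_entry_def path_entry_def numeral_poly)
      next
        case 4
        then have "m + 2 - i \<noteq> m + 2 - j" "m + 2 - i \<noteq> Suc (m + 2 - j)"
          "m + 2 - j \<noteq> Suc (m + 2 - i)"
          using ij by arith+
        then have "path_entry y (m + 2 - i) (m + 2 - j) = 0"
          by (simp add: path_entry_def)
        moreover have "A $$ (Suc i, Suc j) = 0"
          using ij 4 by (simp add: A_entry) (simp add: cartan_B_affine_entry_def)
        ultimately show ?thesis
          by simp
      qed (use ij in \<open>simp add: A_entry path_entry_def\<close>)
    qed
    also have "\<dots> = path_mat y (m + 3) $$ (i, j)"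
      using ij by (simp add: path_mat_def)
    finally show "mat_delete A 0 0 $$ (i, j) = path_mat y (m + 3) $$ (i, j)" .
  qed (use A in \<open>auto simp: path_mat_def\<close>)
  define B where "B = mat_delete (path_mat y (m + 3)) 1 1"
  have B: "B \<in> carrier_mat (m + 2) (m + 2)"
    by (simp add: B_def path_mat_def mat_delete_def)
  have B_entry: "B $$ (i, j) = path_entry y
      (m + 2 - (if i = 0 then 0 else Suc i)) (m + 2 - (if j = 0 then 0 else Suc j))"
    if "i < m + 2" "j < m + 2" for i j
    using that by (auto simp: B_def path_mat_def mat_delete_def)
  have B_path: "mat_delete B 0 0 = path_mat y (m + 1)"
    using B by (intro eq_matI) (auto simp: B_entry mat_delete_def path_mat_def)
  have "det B = y * det (path_mat y (m + 1))"
    \<comment> \<open>An isolated vertex is a leaf whose edge, here to the next vertex, has weight zero.\<close>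
    by (subst det_pendant_vertex[OF B, of 1])
       (auto simp: B_path, auto simp: B_entry path_entry_def)
  moreover have "det A = y * det (path_mat y (m + 3)) - det B"
    by (subst det_pendant_vertex[OF A, of 2])
       (auto simp: A_path B_def, auto simp: A_entry cartan_B_affine_entry_def)
  ultimately show ?thesis
    by (simp add: char_poly_def A_def algebra_simps)
qed

theorem proposition2:
  fixes n :: nat
  assumes "n \<ge> 4"
  shows "char_poly (cartan_B_affine n) =
    [:0, 1:] * [:-2, 1:] * [:-4, 1:] *
    (\<Sum>j = 0..n - 3. monom ((-1) ^ (n + j + 1) * int ((n + j - 2) choose (2 * j + 1))) j)"
proof -
  obtain m where n: "n = m + 4"
    using assms by (metis le_add_diff_inverse2)
  define y :: "int poly" where "y = [:-2, 1:]"
  have "char_poly (cartan_B_affine n) = y * (y * y - 4) * cheb_poly (m + 1)"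
    unfolding n char_poly_cartan_B_affine_eq_paths[OF y_def] det_path_mat_diff[OF y_def]
    by (simp only: mult.assoc)
  also have "y * (y * y - 4) = [:0, 1:] * [:-2, 1:] * [:-4, 1:]"
    by (simp add: y_def numeral_poly)
  also have "cheb_poly (m + 1) =
      (\<Sum>j = 0..n - 3. monom ((-1) ^ (n + j + 1) * int ((n + j - 2) choose (2 * j + 1))) j)"
    unfolding cheb_poly_def n by (intro sum.cong) (simp_all add: numeral_eq_Suc)
  finally show ?thesis .
qed

end
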